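(* Let $(K,\nu)$ be a valued field with $K$ algebraically closed. (1) Every closed ball $B=B(a,\delta)$ of $K$ defines a well-specified valuation $\mu=\omega_{(a,\delta)}$ of $K[x]$, which does not depend on the chosen center $a$ of the ball, and every well-specified valuation of $K[x]$ extending $\nu$ is of this form. (2) To every valuation $\mu$ of $K[x]$ extending $\nu$ which is not well-specified one can associate a decreasing family $(B_\alpha=B(a_\alpha,\delta_\alpha))_{\alpha\in A}$ of closed balls of $K$, where $A$ is a totally ordered set without greatest element, whose intersection $\bigcap_{\alpha\in A}B_\alpha$ is empty, such that $\mu$ is defined by $$\mu(x-c)=\sup\{\nu(c-a_\alpha)\ ;\ \alpha\in A\}\qquad\text{for all }c\in K.$$
   Context: Valuations are written additively. $\tilde\Gamma$ is a fixed totally ordered abelian group containing the value group $\Gamma_\nu$ and the value groups of all valuations of $K[x]$ considered. A valuation of $K[x]$ is the restriction of a valuation of $K(x)$. For $a\in K$, $\delta\in\tilde\Gamma$: $\omega_{(a,\delta)}(\sum_j c_j(x-a)^j)=\min_j(\nu(c_j)+j\delta)$ ($c_j\in K$). The closed ball with center $a$ and radius $\delta\in\tilde\Gamma$ is $B(a,\delta)=\{c\in K:\nu(a-c)\ge\delta\}$; a ball is considered together with its radius $\delta$; any $b\in B(a,\delta)$ is a center: $B(a,\delta)=B(b,\delta)$. Since $K$ is algebraically closed, a valuation of $K[x]$ extending $\nu$ is determined by its values on the polynomials $x-c$, $c\in K$. Key polynomials (MacLane). Let $\mu$ be a valuation of $K[x]$. $f,g$ are $\mu$-equivalent if $\mu(f-g)>\mu(f)=\mu(g)$;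 $g$ $\mu$-divides $f$ if $f$ is $\mu$-equivalent to $gh$ for some $h\in K[x]$. A monic polynomial $\phi$ is a key polynomial for $\mu$ if it is $\mu$-irreducible (it does not $\mu$-divide $1$, and if it $\mu$-divides $fg$ it $\mu$-divides $f$ or $g$) and $\mu$-minimal (if $\phi$ $\mu$-divides $f\ne0$ then $\deg f\ge\deg\phi$). If $\gamma>\mu(\phi)$, the augmented valuation $\mu'=[\mu;\mu'(\phi)=\gamma]$ is $\mu'(\sum_j g_j\phi^j)=\min_j(\mu(g_j)+j\gamma)$ where $\deg g_j<\deg\phi$. Also $\omega_{(a,\gamma)}$ is written $[\nu;\mu(x-a)=\gamma]$ and regarded as an augmented valuation. Continuous admissible family: a family $\mathcal C=(\mu_\alpha)_{\alpha\in A}$, $A$ totally ordered without greatest element, with $\mu_\alpha=[\mu;\mu_\alpha(\phi_\alpha)=\gamma_\alpha]$ for a fixed valuation $\mu$ of $K[x]$ (possibly the first member of the family), all $\phi_\alpha$ of the same degree $d$, $(\gamma_\alpha)$ strictly increasing, $\mu_\beta=[\mu_\alpha;\mu_\beta(\phi_\beta)=\gamma_\beta]$ for $\alpha<\beta$, and such that every element of $\tilde\Phi(\mathcal C)=\{f:\mu_\alpha(f)<\mu_\beta(f)\ \forall\alpha<\beta\}$ has degree $>d$. If $\tilde\Phi(\mathcal C)\neq\emptyset$, a limit key polynomial is a monic polynomial $\phi$ of minimal degree in $\tilde\Phi(\mathcal C)$; for $\gamma>\mu_\alpha(\phi)$ for all $\alpha$, the limit augmented valuation $\mu'=[(\mu_\alpha)_{\alpha};\mu'(\phi)=\gamma]$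 is $\mu'(\sum g_j\phi^j)=\min_j(\sup_\alpha\mu_\alpha(g_j)+j\gamma)$, $\deg g_j<\deg\phi$. A valuation of $K[x]$ is well-specified if it is an augmented valuation (including the case $\omega_{(a,\gamma)}$) or a limit augmented valuation.
   Formalization: In (2) the supremum is taken only over those α in A with c not in B_α; over all of A the formula fails at c = a_α, where the set contains ν(0) = ∞ although μ(x − a_α) is finite. *)

theory Defs
  imports
    "HOL-Library.Extended"
    "HOL-Library.Lub_Glb"
    "HOL-Computational_Algebra.Polynomial_Factorial"
begin

text \<open>
  The type \<open>'g\<close> is the fixed totally ordered abelian group in which all valuations take their
  values. Valuations are additive and map into \<open>'g extended\<close>, where \<open>Pinf\<close> is the value of \<open>0\<close>
  and \<open>Minf\<close> is never taken.
\<close>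

definition valuation :: "('k::field \<Rightarrow> 'g::linordered_ab_group_add extended) \<Rightarrow> bool" where
  "valuation v \<longleftrightarrow>
     (\<forall>x. v x \<noteq> Minf) \<and> (\<forall>x. v x = Pinf \<longleftrightarrow> x = 0) \<and>
     (\<forall>x y. v (x * y) = v x + v y) \<and> (\<forall>x y. v (x + y) \<ge> min (v x) (v y))"

text \<open>Valuations of \<open>K[x]\<close> are the restrictions of valuations of \<open>K(x)\<close>.\<close>

definition poly_valuation :: "('a::field poly \<Rightarrow> 'g::linordered_ab_group_add extended) \<Rightarrow> bool" where
  "poly_valuation \<mu> \<longleftrightarrow> (\<exists>w. valuation w \<and> (\<forall>f. \<mu> f = w (to_fract f)))"

definition extends ::
  "('a::field \<Rightarrow> 'g::linordered_ab_group_add extended) \<Rightarrow> ('a poly \<Rightarrow> 'g extended) \<Rightarrow> bool" where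
  "extends \<nu> \<mu> \<longleftrightarrow> (\<forall>c. \<mu> [:c:] = \<nu> c)"

definition nat_scale :: "nat \<Rightarrow> 'g::linordered_ab_group_add \<Rightarrow> 'g" where
  "nat_scale j \<gamma> = (\<Sum>i<j. \<gamma>)"

definition closed_ball ::
  "('a::field \<Rightarrow> 'g::linordered_ab_group_add extended) \<Rightarrow> 'a \<Rightarrow> 'g \<Rightarrow> 'a set" where
  "closed_ball \<nu> a \<delta> = {c. \<nu> (a - c) \<ge> Fin \<delta>}"

text \<open>
  The coefficients \<open>c\<^sub>j\<close> in \<open>f = (\<Sum>j. c\<^sub>j (x - a)\<^sup>j)\<close> are the coefficients of \<open>f (x + a)\<close>;
  they vanish beyond the degree of \<open>f\<close>.
\<close>

definition omega ::
  "('a::field \<Rightarrow> 'g::linordered_ab_group_add extended) \<Rightarrow> 'a \<Rightarrow> 'g \<Rightarrow> 'a poly \<Rightarrow> 'g extended" where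
  "omega \<nu> a \<delta> f =
     Min ((\<lambda>j. \<nu> (coeff (f \<circ>\<^sub>p [:a, 1:]) j) + Fin (nat_scale j \<delta>)) ` {..degree f})"

definition equivalent_in ::
  "('a::field poly \<Rightarrow> 'g::linordered_ab_group_add extended) \<Rightarrow> 'a poly \<Rightarrow> 'a poly \<Rightarrow> bool" where
  "equivalent_in \<mu> f g \<longleftrightarrow> \<mu> (f - g) > \<mu> f \<and> \<mu> f = \<mu> g"

definition divides_in ::
  "('a::field poly \<Rightarrow> 'g::linordered_ab_group_add extended) \<Rightarrow> 'a poly \<Rightarrow> 'a poly \<Rightarrow> bool" where
  "divides_in \<mu> g f \<longleftrightarrow> (\<exists>h. equivalent_in \<mu> f (g * h))"

definition irreducible_in ::
  "('a::field poly \<Rightarrow> 'g::linordered_ab_group_add extended) \<Rightarrow> 'a poly \<Rightarrow> bool" where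
  "irreducible_in \<mu> \<phi> \<longleftrightarrow>
     \<not> divides_in \<mu> \<phi> 1 \<and>
     (\<forall>f g. divides_in \<mu> \<phi> (f * g) \<longrightarrow> divides_in \<mu> \<phi> f \<or> divides_in \<mu> \<phi> g)"

definition minimal_in ::
  "('a::field poly \<Rightarrow> 'g::linordered_ab_group_add extended) \<Rightarrow> 'a poly \<Rightarrow> bool" where
  "minimal_in \<mu> \<phi> \<longleftrightarrow> (\<forall>f. f \<noteq> 0 \<and> divides_in \<mu> \<phi> f \<longrightarrow> degree f \<ge> degree \<phi>)"

definition key_polynomial ::
  "('a::field poly \<Rightarrow> 'g::linordered_ab_group_add extended) \<Rightarrow> 'a poly \<Rightarrow> bool" where
  "key_polynomial \<mu> \<phi> \<longleftrightarrow> lead_coeff \<phi> = 1 \<and> irreducible_in \<mu> \<phi> \<and> minimal_in \<mu> \<phi>"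

text \<open>
  For monic \<open>\<phi>\<close> of positive degree, \<open>digit \<phi> f j\<close> is the coefficient \<open>g\<^sub>j\<close> of the expansion
  \<open>f = (\<Sum>j. g\<^sub>j \<phi>\<^sup>j)\<close> with \<open>deg g\<^sub>j < deg \<phi>\<close>; it vanishes for \<open>j\<close> beyond the degree of \<open>f\<close>.
  A key polynomial has positive degree, since the constant \<open>1\<close> divides \<open>1\<close>.
\<close>

definition digit :: "'a::field poly \<Rightarrow> 'a poly \<Rightarrow> nat \<Rightarrow> 'a poly" where
  "digit \<phi> f j = (f div \<phi> ^ j) mod \<phi>"

lemma digit_expansion:
  fixes f \<phi> :: "'a::field poly"
  assumes "degree \<phi> > 0"
  shows "f = (\<Sum>j\<le>degree f. digit \<phi> f j * \<phi> ^ j)"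
proof -
  have part: "f = (\<Sum>j<n. digit \<phi> f j * \<phi> ^ j) + (f div \<phi> ^ n) * \<phi> ^ n" for n
  proof (induction n)
    case (Suc n)
    have "(f div \<phi> ^ n) = (f div \<phi> ^ n div \<phi>) * \<phi> + digit \<phi> f n"
      by (simp add: digit_def)
    moreover have "f div \<phi> ^ n div \<phi> = f div \<phi> ^ Suc n"
      by (simp only: power_Suc2 poly_div_mult_right)
    ultimately have "(f div \<phi> ^ n) * \<phi> ^ n
        = (f div \<phi> ^ Suc n) * \<phi> ^ Suc n + digit \<phi> f n * \<phi> ^ n"
      by (metis (no_types) distrib_right mult.assoc power_Suc)
    with Suc.IH show ?case by (simp only: sum.lessThan_Suc ac_simps)
  qed simp
  have "degree f < degree (\<phi> ^ Suc (degree f))"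
  proof -
    have "Suc (degree f) * 1 \<le> Suc (degree f) * degree \<phi>"
      using assms by (intro mult_le_mono) auto
    moreover have "\<phi> \<noteq> 0" using assms by auto
    ultimately show ?thesis by (subst degree_power_eq) auto
  qed
  then have "f div \<phi> ^ Suc (degree f) = 0" by (rule div_poly_less)
  with part[of "Suc (degree f)"] show ?thesis by (simp only: lessThan_Suc_atMost) simp
qed

text \<open>\<open>augmentation \<mu> \<phi> \<gamma> \<mu>'\<close>: \<open>\<mu>'\<close> is the augmented valuation \<open>[\<mu>; \<mu>'(\<phi>) = \<gamma>]\<close>.\<close>

definition augmentation ::
  "('a::field poly \<Rightarrow> 'g::linordered_ab_group_add extended) \<Rightarrow> 'a poly \<Rightarrow> 'g \<Rightarrow>
   ('a poly \<Rightarrow> 'g extended) \<Rightarrow> bool" where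
  "augmentation \<mu> \<phi> \<gamma> \<mu>' \<longleftrightarrow>
     poly_valuation \<mu> \<and> key_polynomial \<mu> \<phi> \<and> Fin \<gamma> > \<mu> \<phi> \<and>
     (\<forall>f. \<mu>' f = Min ((\<lambda>j. \<mu> (digit \<phi> f j) + Fin (nat_scale j \<gamma>)) ` {..degree f}))"

definition Phi_tilde ::
  "'i::linorder set \<Rightarrow> ('i \<Rightarrow> 'a::field poly \<Rightarrow> 'g::linordered_ab_group_add extended) \<Rightarrow> 'a poly set"
  where
  "Phi_tilde A M = {f. \<forall>\<alpha>\<in>A. \<forall>\<beta>\<in>A. \<alpha> < \<beta> \<longrightarrow> M \<alpha> f < M \<beta> f}"

text \<open>
  The family is \<open>(M \<alpha>)\<^sub>\<alpha>\<^sub>\<in>\<^sub>A\<close> with \<open>M \<alpha> = [\<mu>; M \<alpha> (\<phi>\<^sub>\<alpha>) = \<gamma>\<^sub>\<alpha>]\<close> for a fixed \<open>\<mu>\<close>. The disjunct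
  \<open>M \<alpha> = \<mu>\<close> is the case in which \<open>\<mu>\<close> is itself the first member; then \<open>\<phi>\<^sub>\<alpha>\<close>, \<open>\<gamma>\<^sub>\<alpha>\<close> for this
  first \<open>\<alpha>\<close> are dummies.
\<close>

definition continuous_admissible_family ::
  "'i::linorder set \<Rightarrow> ('i \<Rightarrow> 'a::field poly \<Rightarrow> 'g::linordered_ab_group_add extended) \<Rightarrow>
   ('i \<Rightarrow> 'a poly) \<Rightarrow> ('i \<Rightarrow> 'g) \<Rightarrow> nat \<Rightarrow> bool" where
  "continuous_admissible_family A M \<phi> \<gamma> d \<longleftrightarrow>
     A \<noteq> {} \<and> (\<forall>\<alpha>\<in>A. \<exists>\<beta>\<in>A. \<alpha> < \<beta>) \<and>
     (\<exists>\<mu>. poly_valuation \<mu> \<and>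
        (\<forall>\<alpha>\<in>A. augmentation \<mu> (\<phi> \<alpha>) (\<gamma> \<alpha>) (M \<alpha>) \<or> (M \<alpha> = \<mu> \<and> (\<forall>\<beta>\<in>A. \<alpha> \<le> \<beta>)))) \<and>
     (\<forall>\<alpha>\<in>A. degree (\<phi> \<alpha>) = d) \<and>
     strict_mono_on A \<gamma> \<and>
     (\<forall>\<alpha>\<in>A. \<forall>\<beta>\<in>A. \<alpha> < \<beta> \<longrightarrow> augmentation (M \<alpha>) (\<phi> \<beta>) (\<gamma> \<beta>) (M \<beta>)) \<and>
     (\<forall>f\<in>Phi_tilde A M. degree f > d)"

definition limit_key_polynomial ::
  "'i::linorder set \<Rightarrow> ('i \<Rightarrow> 'a::field poly \<Rightarrow> 'g::linordered_ab_group_add extended) \<Rightarrow>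
   'a poly \<Rightarrow> bool" where
  "limit_key_polynomial A M \<phi> \<longleftrightarrow>
     lead_coeff \<phi> = 1 \<and> \<phi> \<in> Phi_tilde A M \<and> (\<forall>f\<in>Phi_tilde A M. degree \<phi> \<le> degree f)"

text \<open>
  The group \<open>'g\<close> need not be complete, so suprema are expressed by \<open>isLub\<close>; the ones
  occurring here exist.
\<close>

definition limit_augmentation ::
  "'i::linorder set \<Rightarrow> ('i \<Rightarrow> 'a::field poly \<Rightarrow> 'g::linordered_ab_group_add extended) \<Rightarrow>
   'a poly \<Rightarrow> 'g \<Rightarrow> ('a poly \<Rightarrow> 'g extended) \<Rightarrow> bool" where
  "limit_augmentation A M \<phi> \<gamma> \<mu>' \<longleftrightarrow>
     limit_key_polynomial A M \<phi> \<and> (\<forall>\<alpha>\<in>A. Fin \<gamma> > M \<alpha> \<phi>) \<and>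
     (\<forall>f. \<exists>s. (\<forall>j\<le>degree f. isLub UNIV ((\<lambda>\<alpha>. M \<alpha> (digit \<phi> f j)) ` A) (s j)) \<and>
          \<mu>' f = Min ((\<lambda>j. s j + Fin (nat_scale j \<gamma>)) ` {..degree f}))"

text \<open>
  In the third case the index set is a subset of \<open>'g\<close>. This is no restriction: the \<open>\<gamma>\<^sub>\<alpha>\<close> are
  strictly increasing, so every continuous admissible family can be reindexed by them.
\<close>

definition well_specified ::
  "('a::field \<Rightarrow> 'g::linordered_ab_group_add extended) \<Rightarrow> ('a poly \<Rightarrow> 'g extended) \<Rightarrow> bool" where
  "well_specified \<nu> \<mu> \<longleftrightarrow> poly_valuation \<mu> \<and>
     ((\<exists>a \<gamma>. \<mu> = omega \<nu> a \<gamma>) \<or>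
      (\<exists>\<rho> \<phi> \<gamma>. augmentation \<rho> \<phi> \<gamma> \<mu>) \<or>
      (\<exists>(A :: 'g set) M \<psi> \<eta> d \<phi> \<gamma>.
         continuous_admissible_family A M \<psi> \<eta> d \<and> limit_augmentation A M \<phi> \<gamma> \<mu>))"

text \<open>
  The supremum of the values \<open>\<nu> (c - a\<^sub>\<alpha>)\<close> describing \<open>\<mu> (x - c)\<close>. It ranges over the \<open>\<alpha>\<close> with
  \<open>c \<notin> B\<^sub>\<alpha>\<close>: when \<open>c \<in> B\<^sub>\<alpha>\<close> the value \<open>\<nu> (c - a\<^sub>\<alpha>)\<close> depends on the choice of the centre of
  \<open>B\<^sub>\<alpha>\<close> and carries no information on \<open>\<mu>\<close> (for \<open>c = a\<^sub>\<alpha>\<close> it is \<open>\<nu> 0 = Pinf\<close>).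
\<close>

definition given_by_balls ::
  "('a::field \<Rightarrow> 'g::linordered_ab_group_add extended) \<Rightarrow> 'i set \<Rightarrow> ('i \<Rightarrow> 'a) \<Rightarrow> ('i \<Rightarrow> 'g) \<Rightarrow>
   ('a poly \<Rightarrow> 'g extended) \<Rightarrow> bool" where
  "given_by_balls \<nu> A a \<delta> \<mu> \<longleftrightarrow>
     (\<forall>c. isLub UNIV {\<nu> (c - a \<alpha>) |\<alpha>. \<alpha> \<in> A \<and> c \<notin> closed_ball \<nu> (a \<alpha>) (\<delta> \<alpha>)} (\<mu> [:- c, 1:]))"

end

theory Submission
  imports Defs
begin

text \<open>
  Over an algebraically closed field every nonconstant polynomial splits, so a valuation \<open>\<mu>\<close> of
  \<open>K[x]\<close> extending \<open>\<nu>\<close> is known once the values \<open>\<mu> (x - c)\<close> are (\<open>valuation_eqI_linear\<close>).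
  These values obey the isosceles law: if \<open>\<mu> (x - c) < \<mu> (x - a)\<close>, then
  \<open>\<nu> (a - c) = \<mu> (x - c)\<close> (\<open>linear_less_imp\<close>). Everything depends on whether they have a
  maximum.

  If the maximum \<open>\<delta>\<close> is attained at \<open>a\<close>, the isosceles law gives
  \<open>\<mu> (x - c) = min (\<nu> (a - c)) \<delta>\<close> for all \<open>c\<close>, which are the values of \<open>\<omega>\<close> for the ball
  \<open>B(a, \<delta>)\<close>; hence \<open>\<mu>\<close> is that \<open>\<omega>\<close> (\<open>maximal_linear_imp_omega\<close>). The same criterion shows
  that \<open>\<omega>\<close> does not depend on the centre, since every centre attains the maximum. That \<open>\<omega>\<close>
  is a valuation at all is Gauss's lemma (\<open>gauss_mult\<close>) after the substitution of \<open>x + a\<close>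
  for \<open>x\<close>.

  If there is no maximum, choosing one \<open>a\<close> for each value of \<open>\<mu> (x - a)\<close> gives balls
  \<open>B(a, \<mu> (x - a))\<close>. Such a ball is
  \<open>{c. \<mu> (x - c) \<ge> \<mu> (x - a)}\<close>, so the balls decrease, no point is in all of them, and
  \<open>\<nu> (c - a) = \<mu> (x - c)\<close> as soon as \<open>c\<close> is outside (\<open>no_maximal_linear_imp_balls\<close>).

  There remain the well-specified valuations that are not presented as an \<open>\<omega>\<close>. A key polynomial
  divides one of its linear factors, so by minimality it is itself linear, say \<open>x - a\<close>
  (\<open>key_polynomial_linear\<close>); an augmentation by \<open>x - a\<close> has, by its very formula, the shape of an
  \<open>\<omega>\<close> (\<open>augmentation_linear\<close>). Limit augmentations do not occur: in a continuous admissible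
  family the polynomials \<open>\<phi>\<^sub>\<alpha>\<close> have degree \<open>d = 1\<close>, so no \<open>x - c\<close> can belong to
  \<open>Phi_tilde\<close>, whose elements have degree greater than \<open>d\<close>. The values of every \<open>x - c\<close>,
  hence those of every polynomial, therefore become stationary
  (\<open>continuous_family_stable\<close>), and there is no limit key polynomial.
\<close>

section \<open>Valuations of integral domains\<close>

text \<open>
  Valuations are treated on integral domains because the ultrametric arguments take place in \<open>K[x]\<close>.
  On a field this is \<open>valuation\<close>, and on \<open>K[x]\<close> it amounts to being the restriction of a valuation
  of \<open>K(x)\<close> (\<open>poly_valuation_iff\<close>).
\<close>

locale ring_valuation =
  fixes v :: "'r::idom \<Rightarrow> 'g::linordered_ab_group_add extended"
  assumes not_Minf [simp]: "v x \<noteq> Minf"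
    and Pinf_iff [simp]: "v x = Pinf \<longleftrightarrow> x = 0"
    and mult: "v (x * y) = v x + v y"
    and add: "min (v x) (v y) \<le> v (x + y)"
begin

lemma zero [simp]: "v 0 = Pinf"
  by simp

lemma finiteE:
  assumes "x \<noteq> 0"
  obtains r where "v x = Fin r"
  using assms Pinf_iff[of x] not_Minf[of x] by (cases "v x") auto

lemma one [simp]: "v 1 = 0"
proof -
  obtain r where r: "v 1 = Fin r" by (rule finiteE[of 1]) auto
  have "v 1 = v 1 + v 1" using mult[of 1 1] by simp
  then show ?thesis by (simp add: r zero_extended_def)
qed

text \<open>
  The value of \<open>- 1\<close> is a 2-torsion element, and an ordered group has none but \<open>0\<close>.
\<close>

lemma minus [simp]: "v (- x) = v x"
proof -
  obtain r where r: "v (- 1) = Fin r" by (rule finiteE[of "- 1"]) auto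
  have "v (- 1) + v (- 1) = 0" using mult[of "- 1" "- 1"] by simp
  then have "v (- 1) = 0" by (simp add: r zero_extended_def)
  then show ?thesis using mult[of "- 1" x] by simp
qed

lemma diff_commute: "v (x - y) = v (y - x)"
  using minus[of "x - y"] by simp

text \<open>
  The isosceles law: a larger value of \<open>x + y\<close> would force one on \<open>x = (x + y) - y\<close>.
\<close>

lemma add_eq:
  assumes "v x < v y"
  shows "v (x + y) = v x"
proof -
  have "v x \<le> v (x + y)" using add[of x y] assms by (simp add: min_def split: if_splits)
  moreover have "min (v (x + y)) (v y) \<le> v x" using add[of "x + y" "- y"] by simp
  ultimately show ?thesis using assms by (auto simp: min_def split: if_splits)
qed

text \<open>
  The two bounds on sums carry a shift \<open>t\<close> because the values in \<open>omega\<close> are shifted by multiples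
  of the radius.
\<close>

lemma sum_ge:
  assumes "\<And>i. i \<in> S \<Longrightarrow> b \<le> v (h i) + Fin t"
  shows "b \<le> v (sum h S) + Fin t"
  using assms
proof (induction S rule: infinite_finite_induct)
  case (insert i S)
  have "b \<le> min (v (h i)) (v (sum h S)) + Fin t" using insert by (simp add: min_def)
  also have "\<dots> \<le> v (h i + sum h S) + Fin t" by (rule add_right_mono[OF add])
  finally show ?case using insert by simp
qed auto

lemma sum_greater:
  assumes "\<And>i. i \<in> S \<Longrightarrow> b < v (h i) + Fin t" and "b < Pinf"
  shows "b < v (sum h S) + Fin t"
  using assms
proof (induction S rule: infinite_finite_induct)
  case (insert i S)
  have "b < min (v (h i)) (v (sum h S)) + Fin t" using insert by (simp add: min_def)
  also have "\<dots> \<le> v (h i + sum h S) + Fin t" by (rule add_right_mono[OF add])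
  finally show ?case using insert by simp
qed auto

end

lemma valuation_iff: "valuation v \<longleftrightarrow> ring_valuation v"
  unfolding valuation_def ring_valuation_def by blast

lemma extended_add_strict_left_mono:
  fixes a b c :: "'g::linordered_ab_group_add extended"
  assumes "a < b" "c \<noteq> Pinf" "c \<noteq> Minf"
  shows "c + a < c + b"
  using assms by (cases a; cases b; cases c) auto

text \<open>
  Denominators have finite values, so these differences are never indeterminate.
\<close>

lemma (in ring_valuation) fract_value_well_defined:
  assumes "b \<noteq> 0" "d \<noteq> 0" "Fract a b = Fract c d"
  shows "v a - v b = v c - v d"
proof -
  have eq: "a * d = c * b" using assms by (simp add: eq_fract)
  obtain r s where rs: "v b = Fin r" "v d = Fin s" using assms finiteE by metis
  have "v a + v d = v c + v b" using eq mult by metis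
  then show ?thesis by (cases "v a"; cases "v c") (auto simp: rs algebra_simps)
qed

lemma (in ring_valuation) extend_to_fract:
  "\<exists>w. valuation w \<and> (\<forall>f. w (to_fract f) = v f)"
proof -
  define w where "w q = (THE r. \<exists>a b. b \<noteq> 0 \<and> q = Fract a b \<and> r = v a - v b)" for q
  have w: "w (Fract a b) = v a - v b" if "b \<noteq> 0" for a b
    unfolding w_def
  proof (rule the_equality)
    show "\<exists>a' b'. b' \<noteq> 0 \<and> Fract a b = Fract a' b' \<and> v a - v b = v a' - v b'" using that by blast
    show "r = v a - v b" if "\<exists>a' b'. b' \<noteq> 0 \<and> Fract a b = Fract a' b' \<and> r = v a' - v b'" for r
      using that fract_value_well_defined[OF \<open>b \<noteq> 0\<close>] by fastforce
  qed
  have "ring_valuation w"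
  proof
    fix p q :: "'r fract"
    obtain a b where p: "p = Fract a b" "b \<noteq> 0" by (cases p)
    obtain c d where q: "q = Fract c d" "d \<noteq> 0" by (cases q)
    obtain r where r: "v b = Fin r" using p finiteE by blast
    obtain s where s: "v d = Fin s" using q finiteE by blast
    have bd: "v (b * d) = Fin (r + s)" by (simp add: mult r s)
    show "w p \<noteq> Minf" using p by (cases "v a") (auto simp: w r)
    have "w p = Pinf \<longleftrightarrow> a = 0"
      using p Pinf_iff[of a] not_Minf[of a] by (cases "v a") (auto simp: w r)
    then show "w p = Pinf \<longleftrightarrow> p = 0" using p by (simp add: Zero_fract_def eq_fract)
    show "w (p * q) = w p + w q"
      using p q not_Minf[of a] not_Minf[of c]
      by (cases "v a"; cases "v c") (auto simp: w mult r s algebra_simps)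
    have "w (p + q) = v (a * d + c * b) - Fin (r + s)"
      using p q by (simp add: w bd mult.commute)
    moreover have "min (v a + Fin s) (v c + Fin r) \<le> v (a * d + c * b)"
      using add[of "a * d" "c * b"] by (simp add: mult r s)
    ultimately show "min (w p) (w q) \<le> w (p + q)"
      using p q not_Minf[of a] not_Minf[of c] not_Minf[of "a * d + c * b"]
      by (cases "v a"; cases "v c"; cases "v (a * d + c * b)")
        (auto simp: w r s min_def algebra_simps split: if_splits)
  qed
  moreover have "w (to_fract f) = v f" for f
    by (cases "v f") (auto simp: to_fract_def w zero_extended_def)
  ultimately show ?thesis using valuation_iff by blast
qed

lemma poly_valuation_iff: "poly_valuation \<mu> \<longleftrightarrow> ring_valuation \<mu>"
proof
  assume "poly_valuation \<mu>"
  then obtain w where w: "ring_valuation w" "\<And>f. \<mu> f = w (to_fract f)"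
    unfolding poly_valuation_def valuation_iff by blast
  interpret w: ring_valuation w by fact
  show "ring_valuation \<mu>" by standard (simp_all add: w(2) w.mult w.add)
next
  assume "ring_valuation \<mu>"
  then show "poly_valuation \<mu>"
    unfolding poly_valuation_def using ring_valuation.extend_to_fract by metis
qed

section \<open>The valuation of a ball\<close>

lemma nat_scale_0 [simp]: "nat_scale 0 \<delta> = 0"
  and nat_scale_1 [simp]: "nat_scale (Suc 0) \<delta> = \<delta>"
  by (simp_all add: nat_scale_def)

lemma nat_scale_add: "nat_scale (i + j) \<delta> = nat_scale i \<delta> + nat_scale j \<delta>"
  by (induction j) (simp_all add: nat_scale_def algebra_simps)

context ring_valuation
begin

definition term_value :: "'g \<Rightarrow> 'r poly \<Rightarrow> nat \<Rightarrow> 'g extended" where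
  "term_value \<delta> f j = v (coeff f j) + Fin (nat_scale j \<delta>)"

text \<open>
  This is \<open>omega\<close> with centre \<open>0\<close>, over an integral domain.
\<close>

definition gauss :: "'g \<Rightarrow> 'r poly \<Rightarrow> 'g extended" where
  "gauss \<delta> f = Min (term_value \<delta> f ` {..degree f})"

lemma gauss_le: "gauss \<delta> f \<le> term_value \<delta> f j"
proof (cases "j \<le> degree f")
  case False
  then have "term_value \<delta> f j = Pinf" by (simp add: term_value_def coeff_eq_0)
  then show ?thesis by simp
qed (simp add: gauss_def)

lemma gauss_attained: "\<exists>j. gauss \<delta> f = term_value \<delta> f j"
proof -
  have "gauss \<delta> f \<in> term_value \<delta> f ` {..degree f}" unfolding gauss_def by (rule Min_in) auto
  then show ?thesis by blast
qed

lemma term_value_not_Minf: "term_value \<delta> f j \<noteq> Minf"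
  using not_Minf[of "coeff f j"] by (cases "v (coeff f j)") (auto simp: term_value_def)

lemma gauss_not_Minf: "gauss \<delta> f \<noteq> Minf"
  using gauss_attained[of \<delta> f] term_value_not_Minf by metis

lemma gauss_Pinf_iff: "gauss \<delta> f = Pinf \<longleftrightarrow> f = 0"
proof
  assume "gauss \<delta> f = Pinf"
  then have "term_value \<delta> f j = Pinf" for j using gauss_le[of \<delta> f j] by simp
  then have "v (coeff f j) = Pinf" for j unfolding term_value_def
    by (metis extended.exhaust extended.distinct(1) not_Minf plus_extended.simps(1))
  then show "f = 0" by (simp add: poly_eq_iff)
next
  assume "f = 0"
  then show "gauss \<delta> f = Pinf" by (simp add: gauss_def term_value_def)
qed

lemma gauss_add: "min (gauss \<delta> f) (gauss \<delta> g) \<le> gauss \<delta> (f + g)"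
proof -
  obtain j where j: "gauss \<delta> (f + g) = term_value \<delta> (f + g) j" using gauss_attained by blast
  have "min (gauss \<delta> f) (gauss \<delta> g) \<le> min (term_value \<delta> f j) (term_value \<delta> g j)"
    by (intro min.mono gauss_le)
  also have "\<dots> \<le> min (v (coeff f j)) (v (coeff g j)) + Fin (nat_scale j \<delta>)"
    unfolding term_value_def by (subst (2) min_def) simp
  also have "\<dots> \<le> term_value \<delta> (f + g) j"
    unfolding term_value_def coeff_add by (rule add_right_mono[OF add])
  finally show ?thesis by (simp only: j)
qed

lemma term_value_mult:
  "v (coeff f i * coeff g j) + Fin (nat_scale (i + j) \<delta>) = term_value \<delta> f i + term_value \<delta> g j"
proof -
  have "Fin (nat_scale (i + j) \<delta>) = Fin (nat_scale i \<delta>) + Fin (nat_scale j \<delta>)"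
    by (simp add: nat_scale_add)
  then show ?thesis unfolding mult term_value_def by (simp only: ac_simps)
qed

text \<open>
  Gauss's lemma: the first term of least value in \<open>f\<close> and the first one in \<open>g\<close> multiply to a term
  of \<open>f * g\<close> with the expected value; every other contribution to the same coefficient involves an
  earlier term of \<open>f\<close> or of \<open>g\<close>, so its value is strictly larger and it cannot cancel that term.
\<close>

lemma gauss_mult: "gauss \<delta> (f * g) = gauss \<delta> f + gauss \<delta> g"
proof (cases "f = 0 \<or> g = 0")
  case True
  have "gauss \<delta> h + Pinf = Pinf" "Pinf + gauss \<delta> h = Pinf" for h
    using gauss_not_Minf[of \<delta> h] by (cases "gauss \<delta> h"; simp)+
  moreover have "gauss \<delta> 0 = Pinf" by (simp add: gauss_Pinf_iff)
  ultimately show ?thesis using True by auto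
next
  case False
  let ?F = "gauss \<delta> f" and ?G = "gauss \<delta> g"
  have fin: "?F \<noteq> Pinf" "?F \<noteq> Minf" "?G \<noteq> Pinf" "?G \<noteq> Minf"
    using False by (auto simp: gauss_Pinf_iff gauss_not_Minf)
  then have finFG: "?F + ?G < Pinf" by (cases ?F; cases ?G) auto
  show ?thesis
  proof (rule antisym)
    define k where "k = (LEAST j. ?F = term_value \<delta> f j)"
    define l where "l = (LEAST j. ?G = term_value \<delta> g j)"
    have k: "?F = term_value \<delta> f k" and l: "?G = term_value \<delta> g l"
      unfolding k_def l_def by (rule LeastI_ex, rule gauss_attained)+
    have before_k: "?F < term_value \<delta> f i" if "i < k" for i
      using not_less_Least[OF that[unfolded k_def]] gauss_le[of \<delta> f i]
      by (rule order.not_eq_order_implies_strict)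
    have before_l: "?G < term_value \<delta> g i" if "i < l" for i
      using not_less_Least[OF that[unfolded l_def]] gauss_le[of \<delta> g i]
      by (rule order.not_eq_order_implies_strict)
    define h where "h i = coeff f i * coeff g (k + l - i)" for i
    have h: "v (h i) + Fin (nat_scale (k + l) \<delta>) = term_value \<delta> f i + term_value \<delta> g (k + l - i)"
      if "i \<le> k + l" for i
      using term_value_mult[of f i g "k + l - i" \<delta>] that by (simp add: h_def)
    have others: "?F + ?G < v (sum h ({..k + l} - {k})) + Fin (nat_scale (k + l) \<delta>)"
    proof (rule sum_greater[OF _ finFG])
      fix i assume i: "i \<in> {..k + l} - {k}"
      have "?F + ?G < term_value \<delta> f i + term_value \<delta> g (k + l - i)"
      proof (cases "i < k")
        case True
        have "?G + ?F < ?G + term_value \<delta> f i"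
          using before_k[OF True] fin by (intro extended_add_strict_left_mono)
        also have "\<dots> \<le> term_value \<delta> g (k + l - i) + term_value \<delta> f i"
          by (rule add_right_mono[OF gauss_le])
        finally show ?thesis by (simp only: add.commute)
      next
        case False
        with i have "k + l - i < l" by auto
        then have "?F + ?G < ?F + term_value \<delta> g (k + l - i)"
          using before_l fin by (intro extended_add_strict_left_mono)
        also have "\<dots> \<le> term_value \<delta> f i + term_value \<delta> g (k + l - i)"
          by (rule add_right_mono[OF gauss_le])
        finally show ?thesis .
      qed
      then show "?F + ?G < v (h i) + Fin (nat_scale (k + l) \<delta>)" using i by (simp add: h)
    qed
    have main: "v (h k) + Fin (nat_scale (k + l) \<delta>) = ?F + ?G" using h[of k] by (simp add: k l)
    have "v (h k) < v (sum h ({..k + l} - {k}))"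
    proof (rule ccontr)
      assume "\<not> ?thesis"
      then have "v (sum h ({..k + l} - {k})) + Fin (nat_scale (k + l) \<delta>)
          \<le> v (h k) + Fin (nat_scale (k + l) \<delta>)" by (intro add_right_mono) simp
      then show False using others unfolding main by (simp add: not_less[symmetric])
    qed
    then have "v (h k + sum h ({..k + l} - {k})) = v (h k)" by (rule add_eq)
    moreover have "coeff (f * g) (k + l) = h k + sum h ({..k + l} - {k})"
      unfolding coeff_mult h_def by (subst sum.remove[of _ k]) auto
    ultimately have "term_value \<delta> (f * g) (k + l) = ?F + ?G"
      by (simp add: term_value_def main)
    then show "gauss \<delta> (f * g) \<le> ?F + ?G" using gauss_le[of \<delta> "f * g" "k + l"] by simp
  next
    obtain n where n: "gauss \<delta> (f * g) = term_value \<delta> (f * g) n" using gauss_attained by blast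
    have "?F + ?G \<le> v (coeff f i * coeff g (n - i)) + Fin (nat_scale n \<delta>)" if "i \<le> n" for i
      using term_value_mult[of f i g "n - i" \<delta>] that by (simp add: add_mono gauss_le)
    then have "?F + ?G \<le> v (\<Sum>i\<le>n. coeff f i * coeff g (n - i)) + Fin (nat_scale n \<delta>)"
      by (intro sum_ge) auto
    then show "?F + ?G \<le> gauss \<delta> (f * g)" by (simp add: n term_value_def coeff_mult)
  qed
qed

lemma gauss_valuation: "ring_valuation (gauss \<delta>)"
  by standard (simp_all add: gauss_not_Minf gauss_Pinf_iff gauss_mult gauss_add)

end

lemma omega_conv_gauss:
  assumes "ring_valuation \<nu>"
  shows "omega \<nu> a \<delta> f = ring_valuation.gauss \<nu> \<delta> (f \<circ>\<^sub>p [:a, 1:])"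
  unfolding omega_def ring_valuation.gauss_def[OF assms] ring_valuation.term_value_def[OF assms]
  by (simp add: degree_pcompose)

lemma omega_valuation:
  assumes "ring_valuation \<nu>"
  shows "ring_valuation (omega \<nu> a \<delta>)"
proof -
  interpret \<nu>: ring_valuation \<nu> by fact
  interpret G: ring_valuation "\<nu>.gauss \<delta>" by (rule \<nu>.gauss_valuation)
  have "f \<circ>\<^sub>p [:a, 1:] = 0 \<longleftrightarrow> f = 0" for f :: "'a poly"
    by (rule pcompose_eq_0_iff) simp
  then show ?thesis
    by unfold_locales (simp_all add: omega_conv_gauss[OF assms] pcompose_mult pcompose_add G.mult G.add)
qed

lemma omega_const: "omega \<nu> a \<delta> [:c:] = \<nu> c"
  by (simp add: omega_def flip: zero_extended_def)

lemma omega_linear: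
  assumes "ring_valuation \<nu>"
  shows "omega \<nu> a \<delta> [:- c, 1:] = min (\<nu> (a - c)) (Fin \<delta>)"
proof -
  interpret \<nu>: ring_valuation \<nu> by fact
  have "{..Suc 0} = {0, 1}" by auto
  then show ?thesis
    by (simp add: omega_def pcompose_pCons flip: zero_extended_def)
qed

section \<open>Valuations over an algebraically closed field\<close>

lemma linear_factor_induct [case_names const factor]:
  fixes f :: "'a::alg_closed_field poly"
  assumes const: "\<And>c. P [:c:]" and factor: "\<And>c p. P p \<Longrightarrow> P ([:- c, 1:] * p)"
  shows "P f"
proof (induction "degree f" arbitrary: f)
  case 0
  then show ?case using const by (metis degree_eq_zeroE)
next
  case (Suc n)
  obtain c where "poly f c = 0" using alg_closed_imp_poly_has_root[of f] Suc by auto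
  then obtain p where p: "f = [:- c, 1:] * p" by (metis poly_eq_0_iff_dvd dvdE)
  with Suc(2) have "p \<noteq> 0" by auto
  then have "degree f = Suc (degree p)" unfolding p by (subst degree_mult_eq) auto
  then have "P p" using Suc by auto
  then show ?case unfolding p by (rule factor)
qed

lemma valuation_eqI_linear:
  fixes \<mu> \<mu>' :: "'a::alg_closed_field poly \<Rightarrow> 'g::linordered_ab_group_add extended"
  assumes "ring_valuation \<mu>" "ring_valuation \<mu>'"
    and "\<And>c. \<mu> [:c:] = \<mu>' [:c:]" and "\<And>c. \<mu> [:- c, 1:] = \<mu>' [:- c, 1:]"
  shows "\<mu> = \<mu>'"
proof
  show "\<mu> f = \<mu>' f" for f
    by (induction f rule: linear_factor_induct)
      (simp_all only: assms(3,4) ring_valuation.mult[OF assms(1)] ring_valuation.mult[OF assms(2)])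
qed

text \<open>
  The constant \<open>a - c\<close> is the difference of \<open>x - c\<close> and \<open>x - a\<close>, so the smaller of their
  values is its own.
\<close>

lemma linear_less_imp:
  fixes \<mu> :: "'a::field poly \<Rightarrow> 'g::linordered_ab_group_add extended"
  assumes "ring_valuation \<mu>" "\<mu> [:- c, 1:] < \<mu> [:- a, 1:]"
  shows "\<mu> [:a - c:] = \<mu> [:- c, 1:]"
proof -
  interpret ring_valuation \<mu> by fact
  have "\<mu> ([:- c, 1:] + - [:- a, 1:]) = \<mu> [:- c, 1:]" by (rule add_eq) (simp only: minus assms(2))
  then show ?thesis by simp
qed

text \<open>
  If \<open>\<mu> (x - c) < \<delta>\<close>, the isosceles law gives \<open>\<nu> (a - c) = \<mu> (x - c)\<close>; if \<open>\<mu> (x - c) = \<delta>\<close>,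
  then \<open>\<nu> (a - c) \<ge> \<delta>\<close>. In both cases \<open>\<mu> (x - c)\<close> is the minimum of \<open>\<nu> (a - c)\<close> and \<open>\<delta>\<close>.
\<close>

lemma maximal_linear_imp_omega:
  fixes \<mu> :: "'a::alg_closed_field poly \<Rightarrow> 'g::linordered_ab_group_add extended"
  assumes \<nu>: "ring_valuation \<nu>" and \<mu>: "ring_valuation \<mu>" and ext: "extends \<nu> \<mu>"
    and max: "\<And>c. \<mu> [:- c, 1:] \<le> \<mu> [:- a, 1:]" and \<delta>: "\<mu> [:- a, 1:] = Fin \<delta>"
  shows "\<mu> = omega \<nu> a \<delta>"
proof (rule valuation_eqI_linear[OF \<mu> omega_valuation[OF \<nu>]])
  interpret \<mu>: ring_valuation \<mu> by fact
  have const: "\<mu> [:c:] = \<nu> c" for c using ext by (simp add: extends_def)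
  show "\<mu> [:c:] = omega \<nu> a \<delta> [:c:]" for c by (simp add: omega_const const)
  show "\<mu> [:- c, 1:] = omega \<nu> a \<delta> [:- c, 1:]" for c
  proof (cases "\<mu> [:- c, 1:] < \<mu> [:- a, 1:]")
    case True
    then show ?thesis
      using linear_less_imp[OF \<mu> True] by (auto simp: omega_linear[OF \<nu>] const \<delta> min_def)
  next
    case False
    then have eq: "\<mu> [:- c, 1:] = Fin \<delta>" using max[of c] \<delta> by simp
    have "min (\<mu> [:- c, 1:]) (\<mu> (- [:- a, 1:])) \<le> \<mu> ([:- c, 1:] + - [:- a, 1:])" by (rule \<mu>.add)
    then have "Fin \<delta> \<le> \<nu> (a - c)" by (simp only: \<mu>.minus \<delta> eq) (simp add: const)
    then show ?thesis by (simp add: omega_linear[OF \<nu>] eq min_def)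
  qed
qed

section \<open>Well-specified valuations\<close>

lemma mod_linear: "f mod [:- a, 1:] = [:poly f a:]"
  for f :: "'a::field poly"
proof -
  have "f mod [:- a, 1:] = ([:- a, 1:] * synthetic_div f a + [:poly f a:]) mod [:- a, 1:]"
    by (simp only: synthetic_div_correct')
  also have "\<dots> = [:poly f a:] mod [:- a, 1:]" by (rule mod_mult_self4)
  also have "\<dots> = [:poly f a:]" by (rule mod_poly_less) simp
  finally show ?thesis .
qed

text \<open>
  Repeated division by \<open>x - a\<close> computes the Taylor expansion at \<open>a\<close>: the remainder is the value at
  \<open>a\<close>, and the quotient carries the remaining coefficients, moved down by one index.
\<close>

lemma digit_linear: "digit [:- a, 1:] f j = [:coeff (f \<circ>\<^sub>p [:a, 1:]) j:]"
proof (induction j arbitrary: f)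
  case 0
  show ?case by (simp add: digit_def mod_linear)
next
  case (Suc j)
  let ?q = "f div [:- a, 1:]"
  have "f = [:- a, 1:] * ?q + f mod [:- a, 1:]" by (rule mult_div_mod_eq[symmetric])
  then have "f = [:- a, 1:] * ?q + [:poly f a:]" by (simp only: mod_linear)
  then have "f \<circ>\<^sub>p [:a, 1:] = ([:- a, 1:] * ?q + [:poly f a:]) \<circ>\<^sub>p [:a, 1:]" by simp
  also have "\<dots> = pCons (poly f a) (?q \<circ>\<^sub>p [:a, 1:])"
    by (simp only: pcompose_add pcompose_mult) (simp add: pcompose_pCons)
  finally have "coeff (f \<circ>\<^sub>p [:a, 1:]) (Suc j) = coeff (?q \<circ>\<^sub>p [:a, 1:]) j" by simp
  moreover have "digit [:- a, 1:] f (Suc j) = digit [:- a, 1:] ?q j"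
    by (simp only: digit_def power_Suc poly_div_mult_right)
  ultimately show ?case by (simp only: Suc)
qed

lemma divides_in_self:
  assumes "ring_valuation \<mu>" "f \<noteq> 0"
  shows "divides_in \<mu> f f"
proof -
  interpret ring_valuation \<mu> by fact
  obtain r where "\<mu> f = Fin r" using finiteE[OF assms(2)] .
  then have "equivalent_in \<mu> f (f * 1)" by (simp add: equivalent_in_def)
  then show ?thesis unfolding divides_in_def by blast
qed

text \<open>
  A key polynomial \<open>\<phi>\<close> divides itself, hence divides a factor in any splitting \<open>\<phi> = (x - c) p\<close>; the
  factor \<open>p\<close> is excluded by minimality, and \<open>x - c\<close> then bounds the degree of \<open>\<phi>\<close>. Minimality also
  makes \<open>\<mu> \<phi>\<close> the largest value on monic linear polynomials.
\<close>

lemma key_polynomial_linear: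
  fixes \<mu> :: "'a::alg_closed_field poly \<Rightarrow> 'g::linordered_ab_group_add extended"
  assumes \<mu>: "ring_valuation \<mu>" and key: "key_polynomial \<mu> \<phi>"
  obtains a where "\<phi> = [:- a, 1:]" "\<And>c. \<mu> [:- c, 1:] \<le> \<mu> [:- a, 1:]"
proof -
  interpret ring_valuation \<mu> by fact
  have monic: "lead_coeff \<phi> = 1" and no_unit: "\<not> divides_in \<mu> \<phi> 1"
    and prime: "\<And>f g. divides_in \<mu> \<phi> (f * g) \<Longrightarrow> divides_in \<mu> \<phi> f \<or> divides_in \<mu> \<phi> g"
    and least: "\<And>f. f \<noteq> 0 \<Longrightarrow> divides_in \<mu> \<phi> f \<Longrightarrow> degree \<phi> \<le> degree f"
    using key unfolding key_polynomial_def irreducible_in_def minimal_in_def by blast+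
  from monic have nz: "\<phi> \<noteq> 0" by auto
  have "degree \<phi> \<noteq> 0"
  proof
    assume "degree \<phi> = 0"
    with monic have "\<phi> = 1" by (metis degree_eq_zeroE coeff_pCons_0 degree_pCons_0 one_pCons)
    then show False using no_unit divides_in_self[OF \<mu> nz] by simp
  qed
  then obtain c where "poly \<phi> c = 0" using alg_closed_imp_poly_has_root[of \<phi>] by auto
  then obtain p where p: "\<phi> = [:- c, 1:] * p" by (metis poly_eq_0_iff_dvd dvdE)
  with nz have pnz: "p \<noteq> 0" by auto
  then have deg: "degree \<phi> = Suc (degree p)" unfolding p by (subst degree_mult_eq) auto
  then have "\<not> divides_in \<mu> \<phi> p" using least[OF pnz] by auto
  moreover have "divides_in \<mu> \<phi> ([:- c, 1:] * p)"
    using divides_in_self[OF \<mu> nz] unfolding p[symmetric] .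
  ultimately have "divides_in \<mu> \<phi> [:- c, 1:]" using prime by blast
  then have "degree p = 0" using least[of "[:- c, 1:]"] deg by simp
  moreover have "lead_coeff p = 1" using monic unfolding p lead_coeff_mult by simp
  ultimately have "p = 1" by (metis degree_eq_zeroE coeff_pCons_0 degree_pCons_0 one_pCons)
  then have \<phi>: "\<phi> = [:- c, 1:]" using p by simp
  moreover have "\<mu> [:- b, 1:] \<le> \<mu> [:- c, 1:]" for b
  proof (rule ccontr)
    \<comment> \<open>Otherwise \<open>x - c\<close> would be equivalent to the nonzero constant \<open>b - c\<close>, hence divide it.\<close>
    assume "\<not> ?thesis"
    then have less: "\<mu> [:- c, 1:] < \<mu> [:- b, 1:]" by simp
    then have eq: "\<mu> [:b - c:] = \<mu> [:- c, 1:]" by (rule linear_less_imp[OF \<mu>])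
    have "\<mu> ([:b - c:] - \<phi> * 1) = \<mu> [:- b, 1:]"
      using minus[of "[:- b, 1:]"] by (simp add: \<phi>)
    then have "equivalent_in \<mu> [:b - c:] (\<phi> * 1)"
      unfolding equivalent_in_def using less eq by (simp add: \<phi>)
    then have "divides_in \<mu> \<phi> [:b - c:]" unfolding divides_in_def by blast
    moreover have "b \<noteq> c" using less by auto
    ultimately show False using least[of "[:b - c:]"] by (simp add: \<phi>)
  qed
  ultimately show ?thesis using that by blast
qed

text \<open>
  The digits with respect to \<open>x - a\<close> are the Taylor coefficients at \<open>a\<close>, so the formulas defining
  the augmentation and \<open>omega\<close> agree; only the values of \<open>\<rho>\<close> on constants enter.
\<close>

lemma augmentation_linear:
  fixes \<mu> \<rho> :: "'a::alg_closed_field poly \<Rightarrow> 'g::linordered_ab_group_add extended"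
  assumes aug: "augmentation \<rho> \<phi> \<gamma> \<mu>"
  obtains a where "\<phi> = [:- a, 1:]" "\<And>c. \<rho> [:- c, 1:] \<le> \<rho> [:- a, 1:]" "\<rho> [:- a, 1:] < Fin \<gamma>"
    "\<mu> = omega (\<lambda>c. \<rho> [:c:]) a \<gamma>"
proof -
  have "ring_valuation \<rho>" "key_polynomial \<rho> \<phi>" and less: "\<rho> \<phi> < Fin \<gamma>"
    and \<mu>: "\<And>f. \<mu> f = Min ((\<lambda>j. \<rho> (digit \<phi> f j) + Fin (nat_scale j \<gamma>)) ` {..degree f})"
    using aug unfolding augmentation_def poly_valuation_iff by auto
  then obtain a where a: "\<phi> = [:- a, 1:]" "\<And>c. \<rho> [:- c, 1:] \<le> \<rho> [:- a, 1:]"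
    using key_polynomial_linear by blast
  moreover have "\<mu> = omega (\<lambda>c. \<rho> [:c:]) a \<gamma>"
    by (rule ext) (simp add: \<mu> a(1) digit_linear omega_def)
  ultimately show ?thesis using that less by blast
qed

lemma ring_valuation_constants:
  assumes "ring_valuation \<mu>"
  shows "ring_valuation (\<lambda>c. \<mu> [:c:])"
proof -
  interpret ring_valuation \<mu> by fact
  have "\<mu> [:x * y:] = \<mu> [:x:] + \<mu> [:y:]" for x y using mult[of "[:x:]" "[:y:]"] by (simp add: mult.commute)
  moreover have "min (\<mu> [:x:]) (\<mu> [:y:]) \<le> \<mu> [:x + y:]" for x y
    using add[of "[:x:]" "[:y:]"] by simp
  ultimately show ?thesis by unfold_locales simp_all
qed

text \<open>
  It suffices to treat \<open>x - c\<close>, by factorization. As \<open>x - c\<close> has degree \<open>1 = d\<close>, it is not in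
  \<open>Phi_tilde\<close>, so its value fails to grow between some \<open>\<alpha> < \<beta>\<close>. Let \<open>x - a\<close> be the key
  polynomial of \<open>\<beta>\<close>. It has the largest linear value under \<open>M \<alpha>\<close>, and this is less than its new
  value \<open>\<eta> \<beta>\<close>; so \<open>x - c\<close> has a value less than \<open>\<eta> \<beta>\<close> under \<open>M \<beta>\<close>. A later key polynomial
  \<open>x - b\<close> again has the largest linear value under \<open>M \<beta>\<close>, thus at least \<open>\<eta> \<beta>\<close>. By the isosceles
  law the value of \<open>x - c\<close> is that of \<open>b - c\<close>, which the augmentation at \<open>x - b\<close> preserves.
\<close>

lemma continuous_family_stable:
  fixes M :: "'i::linorder \<Rightarrow> 'a::alg_closed_field poly \<Rightarrow> 'g::linordered_ab_group_add extended"
  assumes fam: "continuous_admissible_family A M \<psi> \<eta> d"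
  shows "\<exists>\<beta>\<in>A. \<forall>\<kappa>\<in>A. \<beta> \<le> \<kappa> \<longrightarrow> M \<kappa> f = M \<beta> f"
proof -
  have ne: "A \<noteq> {}" and nomax: "\<And>\<alpha>. \<alpha> \<in> A \<Longrightarrow> \<exists>\<beta>\<in>A. \<alpha> < \<beta>"
    and deg: "\<And>\<alpha>. \<alpha> \<in> A \<Longrightarrow> degree (\<psi> \<alpha>) = d"
    and aug: "\<And>\<alpha> \<beta>. \<alpha> \<in> A \<Longrightarrow> \<beta> \<in> A \<Longrightarrow> \<alpha> < \<beta> \<Longrightarrow> augmentation (M \<alpha>) (\<psi> \<beta>) (\<eta> \<beta>) (M \<beta>)"
    and Phi: "\<And>f. f \<in> Phi_tilde A M \<Longrightarrow> d < degree f"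
    using fam unfolding continuous_admissible_family_def by blast+
  \<comment> \<open>A member with a predecessor is an augmentation, whereas a first member need not be one.\<close>
  obtain \<alpha>0 \<alpha>1 where \<alpha>01: "\<alpha>0 \<in> A" "\<alpha>1 \<in> A" "\<alpha>0 < \<alpha>1" using ne nomax by blast
  have M: "ring_valuation (M \<alpha>)" if "\<alpha> \<in> A" for \<alpha>
    using that nomax aug unfolding augmentation_def poly_valuation_iff by blast
  have M_const: "M \<beta> [:c:] = M \<alpha> [:c:]" if "\<alpha> \<in> A" "\<beta> \<in> A" "\<alpha> < \<beta>" for \<alpha> \<beta> c
    using augmentation_linear[OF aug[OF that]] omega_const by metis
  obtain a1 where "\<psi> \<alpha>1 = [:- a1, 1:]" using augmentation_linear[OF aug[OF \<alpha>01]] .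
  then have d: "d = 1" using deg[OF \<alpha>01(2)] by simp
  have lin: "\<exists>\<beta>\<in>A. \<forall>\<kappa>\<in>A. \<beta> \<le> \<kappa> \<longrightarrow> M \<kappa> [:- c, 1:] = M \<beta> [:- c, 1:]" for c
  proof -
    have "[:- c, 1:] \<notin> Phi_tilde A M" using Phi[of "[:- c, 1:]"] d by auto
    then obtain \<alpha> \<beta> where \<alpha>\<beta>: "\<alpha> \<in> A" "\<beta> \<in> A" "\<alpha> < \<beta>" "M \<beta> [:- c, 1:] \<le> M \<alpha> [:- c, 1:]"
      unfolding Phi_tilde_def by fastforce
    obtain a where a: "\<And>c. M \<alpha> [:- c, 1:] \<le> M \<alpha> [:- a, 1:]" "M \<alpha> [:- a, 1:] < Fin (\<eta> \<beta>)"
      "M \<beta> = omega (\<lambda>c. M \<alpha> [:c:]) a (\<eta> \<beta>)"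
      using augmentation_linear[OF aug[OF \<alpha>\<beta>(1-3)]] by metis
    have "M \<beta> [:- a, 1:] = min (M \<alpha> [:a - a:]) (Fin (\<eta> \<beta>))"
      unfolding a(3) by (rule omega_linear[OF ring_valuation_constants[OF M[OF \<alpha>\<beta>(1)]]])
    then have \<beta>_a: "M \<beta> [:- a, 1:] = Fin (\<eta> \<beta>)"
      using ring_valuation.zero[OF M[OF \<alpha>\<beta>(1)]] by simp
    have \<beta>_c: "M \<beta> [:- c, 1:] < Fin (\<eta> \<beta>)"
      using \<alpha>\<beta>(4) a(1)[of c] a(2) by (meson order_le_less_trans)
    have "M \<kappa> [:- c, 1:] = M \<beta> [:- c, 1:]" if \<kappa>: "\<kappa> \<in> A" "\<beta> < \<kappa>" for \<kappa>
    proof -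
      obtain b where b: "\<And>c. M \<beta> [:- c, 1:] \<le> M \<beta> [:- b, 1:]" "M \<beta> [:- b, 1:] < Fin (\<eta> \<kappa>)"
        "M \<kappa> = omega (\<lambda>c. M \<beta> [:c:]) b (\<eta> \<kappa>)"
        using augmentation_linear[OF aug[OF \<alpha>\<beta>(2) \<kappa>]] by metis
      have "M \<kappa> [:- c, 1:] = min (M \<beta> [:b - c:]) (Fin (\<eta> \<kappa>))"
        unfolding b(3) by (rule omega_linear[OF ring_valuation_constants[OF M[OF \<alpha>\<beta>(2)]]])
      moreover have less: "M \<beta> [:- c, 1:] < M \<beta> [:- b, 1:]"
        using b(1)[of a] \<beta>_c unfolding \<beta>_a by (rule order_less_le_trans[rotated])
      moreover have "M \<beta> [:b - c:] = M \<beta> [:- c, 1:]"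
        by (rule linear_less_imp[OF M[OF \<alpha>\<beta>(2)] less])
      ultimately show ?thesis using b(2) by (auto simp: min_def)
    qed
    then show ?thesis using \<alpha>\<beta>(2) by (metis order_le_less)
  qed
  show ?thesis
  proof (induction f rule: linear_factor_induct)
    case (const c)
    have "M \<kappa> [:c:] = M \<alpha>1 [:c:]" if "\<kappa> \<in> A" "\<alpha>1 \<le> \<kappa>" for \<kappa>
      using M_const[OF \<alpha>01(2) that(1)] that(2) by (cases "\<alpha>1 = \<kappa>") auto
    then show ?case using \<alpha>01(2) by blast
  next
    case (factor c p)
    obtain \<beta> where \<beta>: "\<beta> \<in> A" "\<And>\<kappa>. \<kappa> \<in> A \<Longrightarrow> \<beta> \<le> \<kappa> \<Longrightarrow> M \<kappa> p = M \<beta> p" using factor by blast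
    obtain \<beta>' where \<beta>': "\<beta>' \<in> A" "\<And>\<kappa>. \<kappa> \<in> A \<Longrightarrow> \<beta>' \<le> \<kappa> \<Longrightarrow> M \<kappa> [:- c, 1:] = M \<beta>' [:- c, 1:]"
      using lin by blast
    have prod: "M \<kappa> ([:- c, 1:] * p) = M \<beta>' [:- c, 1:] + M \<beta> p"
      if "\<kappa> \<in> A" "\<beta> \<le> \<kappa>" "\<beta>' \<le> \<kappa>" for \<kappa>
      unfolding ring_valuation.mult[OF M[OF that(1)]] using that \<beta>(2) \<beta>'(2) by metis
    have "max \<beta> \<beta>' \<in> A" using \<beta>(1) \<beta>'(1) by (simp add: max_def)
    then show ?case using prod by (intro bexI[of _ "max \<beta> \<beta>'"]) simp_all
  qed
qed

lemma no_limit_augmentation: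
  fixes M :: "'i::linorder \<Rightarrow> 'a::alg_closed_field poly \<Rightarrow> 'g::linordered_ab_group_add extended"
  assumes "continuous_admissible_family A M \<psi> \<eta> d"
  shows "\<not> limit_augmentation A M \<phi> \<gamma> \<mu>"
proof
  assume "limit_augmentation A M \<phi> \<gamma> \<mu>"
  then have \<phi>: "\<phi> \<in> Phi_tilde A M"
    unfolding limit_augmentation_def limit_key_polynomial_def by blast
  obtain \<beta> where \<beta>: "\<beta> \<in> A" "\<And>\<kappa>. \<kappa> \<in> A \<Longrightarrow> \<beta> \<le> \<kappa> \<Longrightarrow> M \<kappa> \<phi> = M \<beta> \<phi>"
    using continuous_family_stable[OF assms] by blast
  obtain \<kappa> where \<kappa>: "\<kappa> \<in> A" "\<beta> < \<kappa>"
    using assms \<beta>(1) unfolding continuous_admissible_family_def by blast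
  have "M \<beta> \<phi> < M \<kappa> \<phi>" using \<phi> \<beta>(1) \<kappa> unfolding Phi_tilde_def by blast
  then show False using \<beta>(2)[of \<kappa>] \<kappa> by simp
qed

lemma well_specified_imp_omega:
  fixes \<nu> :: "'a::alg_closed_field \<Rightarrow> 'g::linordered_ab_group_add extended"
  assumes "well_specified \<nu> \<mu>" "extends \<nu> \<mu>"
  shows "\<exists>a \<delta>. \<mu> = omega \<nu> a \<delta>"
proof -
  consider a \<gamma> where "\<mu> = omega \<nu> a \<gamma>" | \<rho> \<phi> \<gamma> where "augmentation \<rho> \<phi> \<gamma> \<mu>"
    using assms(1) no_limit_augmentation unfolding well_specified_def by blast
  then show ?thesis
  proof cases
    case (2 \<rho> \<phi> \<gamma>)
    then obtain a where a: "\<mu> = omega (\<lambda>c. \<rho> [:c:]) a \<gamma>" using augmentation_linear by metis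
    have "\<rho> [:c:] = \<nu> c" for c using assms(2) unfolding extends_def a omega_const by simp
    then show ?thesis using a by auto
  qed blast
qed

section \<open>Centres and families of balls\<close>

lemma center_mem_closed_ball:
  assumes "ring_valuation \<nu>"
  shows "a \<in> closed_ball \<nu> a \<delta>"
  unfolding closed_ball_def by (simp add: ring_valuation.zero[OF assms])

lemma closed_ball_subset:
  assumes \<nu>: "ring_valuation \<nu>" and b: "b \<in> closed_ball \<nu> a \<delta>" and "\<delta> \<le> \<epsilon>"
  shows "closed_ball \<nu> b \<epsilon> \<subseteq> closed_ball \<nu> a \<delta>"
proof
  interpret ring_valuation \<nu> by fact
  fix c assume "c \<in> closed_ball \<nu> b \<epsilon>"
  then have "Fin \<epsilon> \<le> \<nu> (b - c)" by (simp add: closed_ball_def)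
  then have "Fin \<delta> \<le> \<nu> (b - c)" using assms(3) by (cases "\<nu> (b - c)") auto
  then have "Fin \<delta> \<le> min (\<nu> (a - b)) (\<nu> (b - c))" using b by (simp add: closed_ball_def)
  also have "\<dots> \<le> \<nu> (a - c)" using add[of "a - b" "b - c"] by simp
  finally show "c \<in> closed_ball \<nu> a \<delta>" by (simp add: closed_ball_def)
qed

text \<open>
  No value of \<open>\<omega>\<close> on a monic linear polynomial exceeds the radius, and every point \<open>b\<close> of the ball
  attains it; so \<open>b\<close> is as good a centre as \<open>a\<close>.
\<close>

lemma omega_center_independent:
  fixes \<nu> :: "'a::alg_closed_field \<Rightarrow> 'g::linordered_ab_group_add extended"
  assumes \<nu>: "ring_valuation \<nu>" and b: "b \<in> closed_ball \<nu> a \<delta>"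
  shows "omega \<nu> a \<delta> = omega \<nu> b \<delta>"
proof (rule maximal_linear_imp_omega[OF \<nu> omega_valuation[OF \<nu>]])
  show "extends \<nu> (omega \<nu> a \<delta>)" by (simp add: extends_def omega_const)
  show b': "omega \<nu> a \<delta> [:- b, 1:] = Fin \<delta>"
    using b by (simp add: omega_linear[OF \<nu>] closed_ball_def min_def)
  show "omega \<nu> a \<delta> [:- c, 1:] \<le> omega \<nu> a \<delta> [:- b, 1:]" for c
    unfolding b' by (simp add: omega_linear[OF \<nu>])
qed

lemma isLub_singleton: "isLub UNIV {m::'b::order} m"
  by (auto simp: isLub_def leastP_def setle_def setge_def isUb_def)

text \<open>
  The index set is the set of values \<open>\<mu> (x - c)\<close>, each serving as the radius of its own ball, with
  any point of that value as centre. For a fixed \<open>c\<close>, all \<open>\<alpha>\<close> whose ball omits \<open>c\<close> give the same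
  \<open>\<nu> (c - a \<alpha>)\<close>, and there are such \<open>\<alpha>\<close> because there is no maximum; the supremum describing
  \<open>\<mu> (x - c)\<close> is therefore taken over a single value.
\<close>

lemma no_maximal_linear_imp_balls:
  fixes \<nu> :: "'a::alg_closed_field \<Rightarrow> 'g::linordered_ab_group_add extended"
  assumes \<nu>: "ring_valuation \<nu>" and \<mu>: "ring_valuation \<mu>" and ext: "extends \<nu> \<mu>"
    and nomax: "\<And>a. \<exists>c. \<mu> [:- a, 1:] < \<mu> [:- c, 1:]"
  obtains A :: "'g set" and a where "A \<noteq> {}" "\<And>\<alpha>. \<alpha> \<in> A \<Longrightarrow> \<exists>\<beta>\<in>A. \<alpha> < \<beta>"
    "\<And>\<alpha> \<beta>. \<alpha> \<in> A \<Longrightarrow> \<beta> \<in> A \<Longrightarrow> \<alpha> < \<beta> \<Longrightarrow> closed_ball \<nu> (a \<beta>) \<beta> \<subset> closed_ball \<nu> (a \<alpha>) \<alpha>"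
    "(\<Inter>\<alpha>\<in>A. closed_ball \<nu> (a \<alpha>) \<alpha>) = {}" "given_by_balls \<nu> A a (\<lambda>\<alpha>. \<alpha>) \<mu>"
proof -
  interpret \<nu>: ring_valuation \<nu> by fact
  interpret \<mu>: ring_valuation \<mu> by fact
  have const: "\<mu> [:c:] = \<nu> c" for c using ext by (simp add: extends_def)
  define A where "A = {\<delta>. \<exists>c. \<mu> [:- c, 1:] = Fin \<delta>}"
  define a where "a \<delta> = (SOME c. \<mu> [:- c, 1:] = Fin \<delta>)" for \<delta>
  have a: "\<mu> [:- a \<alpha>, 1:] = Fin \<alpha>" if "\<alpha> \<in> A" for \<alpha>
    unfolding a_def by (rule someI_ex) (use that in \<open>simp add: A_def\<close>)
  have value_in_A: "\<exists>\<beta>\<in>A. \<mu> [:- c, 1:] = Fin \<beta>" for c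
  proof -
    obtain \<beta> where "\<mu> [:- c, 1:] = Fin \<beta>" using \<mu>.finiteE[of "[:- c, 1:]"] by auto
    then show ?thesis unfolding A_def by auto
  qed
  have larger: "\<exists>\<beta>\<in>A. \<mu> [:- c, 1:] < Fin \<beta>" for c
  proof -
    obtain c' where "\<mu> [:- c, 1:] < \<mu> [:- c', 1:]" using nomax by blast
    moreover obtain \<beta> where "\<beta> \<in> A" "\<mu> [:- c', 1:] = Fin \<beta>" using value_in_A by blast
    ultimately show ?thesis by auto
  qed
  have outside: "\<nu> (c - a \<alpha>) = \<mu> [:- c, 1:]" if "\<alpha> \<in> A" "\<mu> [:- c, 1:] < Fin \<alpha>" for c \<alpha>
    using linear_less_imp[OF \<mu>, of c "a \<alpha>"] that a \<nu>.diff_commute by (simp add: const)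
  have ball: "c \<in> closed_ball \<nu> (a \<alpha>) \<alpha> \<longleftrightarrow> Fin \<alpha> \<le> \<mu> [:- c, 1:]" if "\<alpha> \<in> A" for c \<alpha>
  proof
    assume c: "c \<in> closed_ball \<nu> (a \<alpha>) \<alpha>"
    show "Fin \<alpha> \<le> \<mu> [:- c, 1:]"
    proof (rule ccontr)
      assume "\<not> ?thesis"
      then show False
        using outside[OF that, of c] c \<nu>.diff_commute[of c "a \<alpha>"] by (simp add: closed_ball_def)
    qed
  next
    assume c: "Fin \<alpha> \<le> \<mu> [:- c, 1:]"
    have "min (\<mu> [:- c, 1:]) (\<mu> (- [:- a \<alpha>, 1:])) \<le> \<mu> ([:- c, 1:] + - [:- a \<alpha>, 1:])"
      by (rule \<mu>.add)
    then have "Fin \<alpha> \<le> \<mu> ([:- c, 1:] + - [:- a \<alpha>, 1:])"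
      unfolding \<mu>.minus a[OF that] using c by (simp add: min_def split: if_splits)
    then show "c \<in> closed_ball \<nu> (a \<alpha>) \<alpha>" by (simp add: const closed_ball_def)
  qed
  show ?thesis
  proof
    show "A \<noteq> {}" using value_in_A by blast
    show "\<exists>\<beta>\<in>A. \<alpha> < \<beta>" if "\<alpha> \<in> A" for \<alpha> using larger[of "a \<alpha>"] a[OF that] by simp
    show "closed_ball \<nu> (a \<beta>) \<beta> \<subset> closed_ball \<nu> (a \<alpha>) \<alpha>"
      if "\<alpha> \<in> A" "\<beta> \<in> A" "\<alpha> < \<beta>" for \<alpha> \<beta>
    proof -
      have "a \<beta> \<in> closed_ball \<nu> (a \<alpha>) \<alpha>" using that by (simp add: ball a)
      then have "closed_ball \<nu> (a \<beta>) \<beta> \<subseteq> closed_ball \<nu> (a \<alpha>) \<alpha>"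
        using that by (intro closed_ball_subset[OF \<nu>]) auto
      moreover have "a \<alpha> \<in> closed_ball \<nu> (a \<alpha>) \<alpha>" "a \<alpha> \<notin> closed_ball \<nu> (a \<beta>) \<beta>"
        using that by (simp_all add: ball a)
      ultimately show ?thesis by blast
    qed
    show "(\<Inter>\<alpha>\<in>A. closed_ball \<nu> (a \<alpha>) \<alpha>) = {}"
    proof (rule equals0I)
      fix c assume c: "c \<in> (\<Inter>\<alpha>\<in>A. closed_ball \<nu> (a \<alpha>) \<alpha>)"
      obtain \<beta> where \<beta>: "\<beta> \<in> A" "\<mu> [:- c, 1:] < Fin \<beta>" using larger by blast
      with c have "Fin \<beta> \<le> \<mu> [:- c, 1:]" using ball by blast
      with \<beta>(2) show False by simp
    qed
    show "given_by_balls \<nu> A a (\<lambda>\<alpha>. \<alpha>) \<mu>"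
      unfolding given_by_balls_def
    proof
      fix c
      have "{\<nu> (c - a \<alpha>) |\<alpha>. \<alpha> \<in> A \<and> c \<notin> closed_ball \<nu> (a \<alpha>) \<alpha>} = {\<mu> [:- c, 1:]}"
      proof -
        have val: "\<nu> (c - a \<alpha>) = \<mu> [:- c, 1:]" if "\<alpha> \<in> A" "c \<notin> closed_ball \<nu> (a \<alpha>) \<alpha>" for \<alpha>
          using that outside[OF that(1)] ball[OF that(1)] not_le by blast
        obtain \<beta> where \<beta>: "\<beta> \<in> A" "c \<notin> closed_ball \<nu> (a \<beta>) \<beta>"
          using larger[of c] ball not_le by blast
        show ?thesis
        proof (rule subset_antisym)
          show "{\<nu> (c - a \<alpha>) |\<alpha>. \<alpha> \<in> A \<and> c \<notin> closed_ball \<nu> (a \<alpha>) \<alpha>} \<subseteq> {\<mu> [:- c, 1:]}"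
            using val by blast
          show "{\<mu> [:- c, 1:]} \<subseteq> {\<nu> (c - a \<alpha>) |\<alpha>. \<alpha> \<in> A \<and> c \<notin> closed_ball \<nu> (a \<alpha>) \<alpha>}"
            unfolding val[OF \<beta>, symmetric] using \<beta> by blast
        qed
      qed
      then show "isLub UNIV {\<nu> (c - a \<alpha>) |\<alpha>. \<alpha> \<in> A \<and> c \<notin> closed_ball \<nu> (a \<alpha>) \<alpha>} (\<mu> [:- c, 1:])"
        by (simp add: isLub_singleton)
    qed
  qed
qed

lemma given_by_balls_unique:
  fixes \<mu> \<mu>' :: "'a::alg_closed_field poly \<Rightarrow> 'g::linordered_ab_group_add extended"
  assumes "ring_valuation \<mu>" "ring_valuation \<mu>'" "extends \<nu> \<mu>" "extends \<nu> \<mu>'"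
    and "given_by_balls \<nu> A a \<delta> \<mu>" "given_by_balls \<nu> A a \<delta> \<mu>'"
  shows "\<mu> = \<mu>'"
proof (rule valuation_eqI_linear[OF assms(1,2)])
  show "\<mu> [:c:] = \<mu>' [:c:]" for c using assms(3,4) by (simp add: extends_def)
  show "\<mu> [:- c, 1:] = \<mu>' [:- c, 1:]" for c
    using assms(5,6) unfolding given_by_balls_def by (blast intro: isLub_unique)
qed

theorem proposition2p11:
  fixes \<nu> :: "'a::alg_closed_field \<Rightarrow> 'g::linordered_ab_group_add extended"
  assumes "valuation \<nu>"
  shows
    "(\<forall>a \<delta>. poly_valuation (omega \<nu> a \<delta>) \<and> extends \<nu> (omega \<nu> a \<delta>) \<and>
            well_specified \<nu> (omega \<nu> a \<delta>)) \<and>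
     (\<forall>a b \<delta>. closed_ball \<nu> a \<delta> = closed_ball \<nu> b \<delta> \<longrightarrow> omega \<nu> a \<delta> = omega \<nu> b \<delta>) \<and>
     (\<forall>\<mu>. well_specified \<nu> \<mu> \<and> extends \<nu> \<mu> \<longrightarrow> (\<exists>a \<delta>. \<mu> = omega \<nu> a \<delta>)) \<and>
     (\<forall>\<mu>. poly_valuation \<mu> \<and> extends \<nu> \<mu> \<and> \<not> well_specified \<nu> \<mu> \<longrightarrow>
        (\<exists>(A :: 'g set) a \<delta>.
           A \<noteq> {} \<and> (\<forall>\<alpha>\<in>A. \<exists>\<beta>\<in>A. \<alpha> < \<beta>) \<and>
           (\<forall>\<alpha>\<in>A. \<forall>\<beta>\<in>A. \<alpha> < \<beta> \<longrightarrow>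
              \<delta> \<alpha> < \<delta> \<beta> \<and> closed_ball \<nu> (a \<beta>) (\<delta> \<beta>) \<subset> closed_ball \<nu> (a \<alpha>) (\<delta> \<alpha>)) \<and>
           (\<Inter>\<alpha>\<in>A. closed_ball \<nu> (a \<alpha>) (\<delta> \<alpha>)) = {} \<and>
           given_by_balls \<nu> A a \<delta> \<mu> \<and>
           (\<forall>\<mu>'. poly_valuation \<mu>' \<and> extends \<nu> \<mu>' \<and> given_by_balls \<nu> A a \<delta> \<mu>' \<longrightarrow> \<mu>' = \<mu>)))"
proof -
  have \<nu>: "ring_valuation \<nu>" using assms by (simp only: valuation_iff)
  have omega: "poly_valuation (omega \<nu> a \<delta>) \<and> extends \<nu> (omega \<nu> a \<delta>) \<and>
      well_specified \<nu> (omega \<nu> a \<delta>)" for a \<delta>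
    using omega_valuation[OF \<nu>]
    by (auto simp: poly_valuation_iff extends_def omega_const well_specified_def)
  have center: "omega \<nu> a \<delta> = omega \<nu> b \<delta>" if "closed_ball \<nu> a \<delta> = closed_ball \<nu> b \<delta>" for a b \<delta>
    using omega_center_independent[OF \<nu>] center_mem_closed_ball[OF \<nu>] that by metis
  have balls: "\<exists>(A :: 'g set) a \<delta>.
      A \<noteq> {} \<and> (\<forall>\<alpha>\<in>A. \<exists>\<beta>\<in>A. \<alpha> < \<beta>) \<and>
      (\<forall>\<alpha>\<in>A. \<forall>\<beta>\<in>A. \<alpha> < \<beta> \<longrightarrow>
         \<delta> \<alpha> < \<delta> \<beta> \<and> closed_ball \<nu> (a \<beta>) (\<delta> \<beta>) \<subset> closed_ball \<nu> (a \<alpha>) (\<delta> \<alpha>)) \<and>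
      (\<Inter>\<alpha>\<in>A. closed_ball \<nu> (a \<alpha>) (\<delta> \<alpha>)) = {} \<and>
      given_by_balls \<nu> A a \<delta> \<mu> \<and>
      (\<forall>\<mu>'. poly_valuation \<mu>' \<and> extends \<nu> \<mu>' \<and> given_by_balls \<nu> A a \<delta> \<mu>' \<longrightarrow> \<mu>' = \<mu>)"
    if "poly_valuation \<mu>" and ext: "extends \<nu> \<mu>" and nws: "\<not> well_specified \<nu> \<mu>" for \<mu>
  proof -
    have \<mu>: "ring_valuation \<mu>" using that(1) by (simp only: poly_valuation_iff)
    have "\<exists>c. \<mu> [:- a, 1:] < \<mu> [:- c, 1:]" for a
    proof (rule ccontr)
      assume "\<not> ?thesis"
      then have "\<mu> [:- c, 1:] \<le> \<mu> [:- a, 1:]" for c by (simp add: not_less)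
      moreover obtain \<delta> where "\<mu> [:- a, 1:] = Fin \<delta>"
        using ring_valuation.finiteE[OF \<mu>, of "[:- a, 1:]"] by auto
      ultimately have "\<mu> = omega \<nu> a \<delta>" by (rule maximal_linear_imp_omega[OF \<nu> \<mu> ext])
      then show False using nws omega by simp
    qed
    then obtain A :: "'g set" and a where A: "A \<noteq> {}" "\<And>\<alpha>. \<alpha> \<in> A \<Longrightarrow> \<exists>\<beta>\<in>A. \<alpha> < \<beta>"
      "\<And>\<alpha> \<beta>. \<alpha> \<in> A \<Longrightarrow> \<beta> \<in> A \<Longrightarrow> \<alpha> < \<beta> \<Longrightarrow> closed_ball \<nu> (a \<beta>) \<beta> \<subset> closed_ball \<nu> (a \<alpha>) \<alpha>"
      "(\<Inter>\<alpha>\<in>A. closed_ball \<nu> (a \<alpha>) \<alpha>) = {}" "given_by_balls \<nu> A a (\<lambda>\<alpha>. \<alpha>) \<mu>"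
      using no_maximal_linear_imp_balls[OF \<nu> \<mu> ext] by blast
    have "\<mu>' = \<mu>" if "poly_valuation \<mu>'" "extends \<nu> \<mu>'" "given_by_balls \<nu> A a (\<lambda>\<alpha>. \<alpha>) \<mu>'" for \<mu>'
      using given_by_balls_unique \<mu> ext A(5) that unfolding poly_valuation_iff by blast
    with A show ?thesis by (intro exI[of _ A] exI[of _ a] exI[of _ "\<lambda>\<alpha>. \<alpha>"]) simp
  qed
  show ?thesis
  proof (intro conjI; intro allI impI; (elim conjE)?)
    fix a \<delta>
    show "poly_valuation (omega \<nu> a \<delta>) \<and> extends \<nu> (omega \<nu> a \<delta>) \<and>
      well_specified \<nu> (omega \<nu> a \<delta>)" by (rule omega)
  next
    fix a b \<delta>
    assume "closed_ball \<nu> a \<delta> = closed_ball \<nu> b \<delta>"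
    then show "omega \<nu> a \<delta> = omega \<nu> b \<delta>" by (rule center)
  next
    fix \<mu>
    assume "well_specified \<nu> \<mu>" "extends \<nu> \<mu>"
    then show "\<exists>a \<delta>. \<mu> = omega \<nu> a \<delta>" by (rule well_specified_imp_omega)
  qed (rule balls)
qed

end
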